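(* Let $0\le c<1$ and let $(p_n)_{n\ge1}$ be a sequence in $[0,1]$ with $p_n=\Omega(n^{-c})$, and for each $n$ let $G_n$ be a random directed acyclic graph drawn from $D(n,p_n)$. Then for all $\epsilon>0$ and $\delta>0$ there exists $N$ such that for all $n\ge N$, $$P[\mathrm{GAPVB}(G_n)<1+\delta]>1-\epsilon.$$
   Context: $p_n=\Omega(n^{-c})$ means there exist $k>0$ and $n_0$ with $p_n \ge k n^{-c}$ for all $n\ge n_0$. The distribution $D(n,p)$ on directed acyclic graphs with vertex set $\{1,\dots,n\}$ is obtained by including each of the $\binom{n}{2}$ pairs $\{i,j\}$ independently with probability $p$ and orienting each included edge from $i$ to $j$ when $i<j$. For a directed acyclic graph $G=(V,E)$ with $|V|=n$, a layout is a bijection $\phi:V\to\{1,\dots,n\}$ such that $\phi(u)<\phi(v)$ for every directed edge $(u,v)\in E$ (a topological ordering). For $1\le i\le n$, let $\sigma(i,\phi,G)$ be the number of vertices $u$ with $\phi(u)\le i$ for which there exists $v$ with $\phi(v)>i$ joined to $u$ by an edge of $G$. Define $\mathrm{VB}(G,\phi)=\sigma(\lfloor n/2\rfloor,\phi,G)$, $\mathrm{MINVB}(G)=\min_\phi\mathrm{VB}(G,\phi)$, $\mathrm{MAXVB}(G)=\max_\phi\mathrm{VB}(G,\phi)$ over all layouts $\phi$ of $G$, and $\mathrm{GAPVB}(G)=\mathrm{MAXVB}(G)/\mathrm{MINVB}(G)$. *)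

theory Defs
  imports
    "HOL-Probability.Probability"
    "HOL-Library.Landau_Symbols"
    "Graph_Theory.Pair_Digraph"
begin

text \<open>
  A pair of vertices is indexed by its increasing representative. \<open>bernoulli_pmf\<close> clips its
  parameter to the unit interval, so this is the intended law only for \<open>0 \<le> p \<le> 1\<close>.
\<close>

definition D :: "nat \<Rightarrow> real \<Rightarrow> nat pair_pre_digraph pmf" where
  "D n p =
    (let pairs = {(i, j). 1 \<le> i \<and> i < j \<and> j \<le> n} in
      map_pmf (\<lambda>f. \<lparr>pverts = {1..n}, parcs = {e \<in> pairs. f e}\<rparr>)
        (Pi_pmf pairs False (\<lambda>_. bernoulli_pmf p)))"

definition layout :: "'a pair_pre_digraph \<Rightarrow> ('a \<Rightarrow> nat) \<Rightarrow> bool" where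
  "layout G \<phi> \<longleftrightarrow>
    bij_betw \<phi> (pverts G) {1..card (pverts G)} \<and> (\<forall>(u, v) \<in> parcs G. \<phi> u < \<phi> v)"

definition \<sigma> :: "nat \<Rightarrow> ('a \<Rightarrow> nat) \<Rightarrow> 'a pair_pre_digraph \<Rightarrow> nat" where
  "\<sigma> i \<phi> G =
    card {u \<in> pverts G. \<phi> u \<le> i \<and>
      (\<exists>v \<in> pverts G. \<phi> v > i \<and> ((u, v) \<in> parcs G \<or> (v, u) \<in> parcs G))}"

definition VB :: "'a pair_pre_digraph \<Rightarrow> ('a \<Rightarrow> nat) \<Rightarrow> nat" where
  "VB G \<phi> = \<sigma> (card (pverts G) div 2) \<phi> G"

definition MINVB :: "'a pair_pre_digraph \<Rightarrow> nat" where
  "MINVB G = Min {VB G \<phi> | \<phi>. layout G \<phi>}"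

definition MAXVB :: "'a pair_pre_digraph \<Rightarrow> nat" where
  "MAXVB G = Max {VB G \<phi> | \<phi>. layout G \<phi>}"

text \<open>
  With the convention \<open>x / 0 = 0\<close> a vanishing minimum would count as a small gap. The value
  \<open>\<infinity>\<close> (also for \<open>0 / 0\<close>) excludes such graphs from every event bounding the gap from above.
\<close>

definition GAPVB :: "'a pair_pre_digraph \<Rightarrow> ereal" where
  "GAPVB G = (if MINVB G = 0 then \<infinity> else ereal (real (MAXVB G) / real (MINVB G)))"

end

theory Submission
  imports Defs "HOL-Real_Asymp.Real_Asymp"
begin

text \<open>
  If every two disjoint sets of at least \<open>\<gamma> n\<close> vertices are joined by an arc, then fewer than
  \<open>\<gamma> n\<close> vertices of the first half of a layout have no neighbour in the second half, so every
  layout has \<open>VB\<close> between \<open>\<lfloor>n/2\<rfloor> - \<gamma> n\<close> and \<open>\<lfloor>n/2\<rfloor>\<close>. A union bound over pairs of vertex sets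
  shows that this expansion property fails with probability at most
  \<open>4^n exp(-p (\<gamma> n)^2)\<close>, which vanishes since \<open>p n^2\<close> grows like \<open>n^(2-c)\<close> with \<open>2 - c > 1\<close>.
\<close>

definition expanding :: "real \<Rightarrow> 'a pair_pre_digraph \<Rightarrow> bool" where
  "expanding s G \<longleftrightarrow>
    (\<forall>A B. A \<subseteq> pverts G \<longrightarrow> B \<subseteq> pverts G \<longrightarrow> A \<inter> B = {} \<longrightarrow> s \<le> card A \<longrightarrow> s \<le> card B \<longrightarrow>
      (\<exists>a\<in>A. \<exists>b\<in>B. (a, b) \<in> parcs G \<or> (b, a) \<in> parcs G))"

lemma card_layout_prefix:
  assumes "layout G \<phi>" "i \<le> card (pverts G)"
  shows "card {u \<in> pverts G. \<phi> u \<le> i} = i"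
proof -
  have bij: "bij_betw \<phi> (pverts G) {1..card (pverts G)}"
    using assms(1) by (simp add: layout_def)
  have "bij_betw \<phi> {u \<in> pverts G. \<phi> u \<le> i} {1..i}"
    unfolding bij_betw_def
  proof
    show "inj_on \<phi> {u \<in> pverts G. \<phi> u \<le> i}"
      using bij by (auto simp: bij_betw_def inj_on_def)
    have img: "\<phi> ` pverts G = {1..card (pverts G)}"
      using bij by (simp add: bij_betw_def)
    show "\<phi> ` {u \<in> pverts G. \<phi> u \<le> i} = {1..i}"
    proof (intro equalityI subsetI)
      fix x assume "x \<in> \<phi> ` {u \<in> pverts G. \<phi> u \<le> i}"
      then show "x \<in> {1..i}" using img by fastforce
    next
      fix x assume x: "x \<in> {1..i}"
      then have "x \<in> \<phi> ` pverts G" using img assms(2) by auto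
      then show "x \<in> \<phi> ` {u \<in> pverts G. \<phi> u \<le> i}" using x by auto
    qed
  qed
  then show ?thesis using bij_betw_same_card by fastforce
qed

lemma VB_le_half:
  assumes "finite (pverts G)" "layout G \<phi>"
  shows "VB G \<phi> \<le> card (pverts G) div 2"
proof -
  let ?h = "card (pverts G) div 2"
  have "VB G \<phi> \<le> card {u \<in> pverts G. \<phi> u \<le> ?h}"
    unfolding VB_def \<sigma>_def using assms(1) by (intro card_mono) auto
  then show ?thesis using card_layout_prefix[OF assms(2), of ?h] by simp
qed

lemma expanding_VB_ge:
  assumes fin: "finite (pverts G)" and lay: "layout G \<phi>"
    and ex: "expanding s G" and s: "s \<le> card (pverts G) / 2"
  shows "real (card (pverts G) div 2) - s \<le> VB G \<phi>"
proof -
  let ?h = "card (pverts G) div 2"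
  define L where "L = {u \<in> pverts G. \<phi> u \<le> ?h}"
  define R where "R = {u \<in> pverts G. \<phi> u > ?h}"
  define X where "X = {u \<in> L. \<exists>v\<in>R. (u, v) \<in> parcs G \<or> (v, u) \<in> parcs G}"
  have VB: "VB G \<phi> = card X"
    unfolding VB_def \<sigma>_def X_def L_def R_def by (rule arg_cong[of _ _ card]) auto
  have cL: "card L = ?h"
    using card_layout_prefix[OF lay, of ?h] by (simp add: L_def)
  have finL: "finite L" "finite R" using fin by (auto simp: L_def R_def)
  have "card (pverts G) = card (L \<union> R)"
    by (rule arg_cong[of _ _ card]) (auto simp: L_def R_def)
  also have "\<dots> = card L + card R"
    using finL by (intro card_Un_disjoint) (auto simp: L_def R_def)
  \<comment> \<open>The rounding is favourable: the prefix takes the floor, so \<open>R\<close>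
    keeps at least half of all vertices and hence at least \<open>s\<close>.\<close>
  finally have cR: "s \<le> card R" using cL s by linarith
  \<comment> \<open>No arc joins \<open>L - X\<close> to \<open>R\<close>, so expansion forbids
    \<open>L - X\<close> from reaching size \<open>s\<close>.\<close>
  have "card (L - X) < s"
  proof (rule ccontr)
    assume "\<not> card (L - X) < s"
    moreover have "L - X \<subseteq> pverts G" "R \<subseteq> pverts G" "(L - X) \<inter> R = {}"
      by (auto simp: L_def R_def)
    ultimately obtain a b where "a \<in> L - X" "b \<in> R" "(a, b) \<in> parcs G \<or> (b, a) \<in> parcs G"
      using ex cR unfolding expanding_def by (metis not_less)
    then show False by (auto simp: X_def)
  qed
  moreover have "card (L - X) = card L - card X" "card X \<le> card L"
    using finL by (auto simp: X_def intro!: card_Diff_subset card_mono)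
  ultimately show ?thesis using VB cL by (simp add: of_nat_diff)
qed

text \<open>With \<open>h\<close> the half size, \<open>VB\<close> lies in [h - s, h] for every
  layout, so the gap is at most h / (h - s). The last assumption is the rearranged inequality h < (1
  + \<delta>) (h - s). The layout \<open>\<phi>\<^sub>0\<close> makes the set of values nonempty, so
  that \<open>Min\<close> and \<open>Max\<close> are meaningful.\<close>

lemma expanding_GAPVB_less:
  assumes fin: "finite (pverts G)" and lay: "layout G \<phi>\<^sub>0"
    and ex: "expanding s G" and s: "s \<le> card (pverts G) / 2"
    and \<delta>: "0 < \<delta>" and h: "(1 + \<delta>) * s < \<delta> * real (card (pverts G) div 2)"
  shows "GAPVB G < ereal (1 + \<delta>)"
proof -
  let ?h = "card (pverts G) div 2" and ?S = "{VB G \<phi> | \<phi>. layout G \<phi>}"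
  have "?S \<subseteq> {..?h}" using VB_le_half[OF fin] by auto
  then have S: "finite ?S" "?S \<noteq> {}" using lay finite_subset by auto
  have max: "MAXVB G \<le> ?h"
    unfolding MAXVB_def using S VB_le_half[OF fin] by (subst Max_le_iff) auto
  have "MINVB G \<in> ?S" unfolding MINVB_def using S by (rule Min_in)
  then have min: "real ?h - s \<le> MINVB G" using expanding_VB_ge[OF fin _ ex s] by auto
  have "real ?h < (1 + \<delta>) * (real ?h - s)" using h by (simp add: algebra_simps)
  also have "\<dots> \<le> (1 + \<delta>) * MINVB G" using min \<delta> by (intro mult_left_mono) auto
  finally have lt: "real ?h < (1 + \<delta>) * MINVB G" .
  \<comment> \<open>The strict inequality excludes a zero minimum, for which \<open>GAPVB\<close> is
    infinite.\<close>
  then have pos: "MINVB G \<noteq> 0" by (auto intro!: gr0I)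
  have "real (MAXVB G) < (1 + \<delta>) * MINVB G" using lt max by linarith
  then show ?thesis using pos by (simp add: GAPVB_def field_simps)
qed

text \<open>The random choices in \<open>D\<close> are indexed by increasing pairs, so every pair
  between \<open>A\<close> and \<open>B\<close> is normalised to the index of the single Bernoulli
  variable deciding whether its ends are joined.\<close>

definition crossing_pairs :: "nat set \<Rightarrow> nat set \<Rightarrow> (nat \<times> nat) set" where
  "crossing_pairs A B = (\<lambda>(a, b). (min a b, max a b)) ` (A \<times> B)"

text \<open>Normalisation could only identify (a, b) with (b, a), and both lie in the product only
  if \<open>A\<close> and \<open>B\<close> intersect.\<close>

lemma card_crossing_pairs:
  assumes "A \<inter> B = {}"
  shows "card (crossing_pairs A B) = card A * card B"
proof -
  have "inj_on (\<lambda>(a, b). (min a b, max a b)) (A \<times> B)"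
    using assms by (auto simp: inj_on_def min_def max_def split: if_splits)
  then show ?thesis by (simp add: crossing_pairs_def card_image card_cartesian_product)
qed

lemma prob_Pi_bernoulli_all_False:
  assumes "finite I" "S \<subseteq> I" "p \<in> {0..1}"
  shows "measure_pmf.prob (Pi_pmf I False (\<lambda>_. bernoulli_pmf p)) {f. \<forall>e\<in>S. \<not> f e}
    = (1 - p) ^ card S"
proof -
  \<comment> \<open>Written as a product set, unrestricted outside \<open>S\<close>, the event
    factorises by independence.\<close>
  have eq: "{f. \<forall>e\<in>S. \<not> f e} = Pi I (\<lambda>e. if e \<in> S then {False} else UNIV)"
    using assms(2) by (auto simp: Pi_def split: if_splits)
  have "measure_pmf.prob (Pi_pmf I False (\<lambda>_. bernoulli_pmf p)) {f. \<forall>e\<in>S. \<not> f e}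
      = (\<Prod>e\<in>I. measure_pmf.prob (bernoulli_pmf p) (if e \<in> S then {False} else UNIV))"
    unfolding eq using assms(1) by (rule measure_Pi_pmf_Pi)
  also have "\<dots> = (\<Prod>e\<in>I. if e \<in> S then 1 - p else 1)"
    using assms(3) by (intro prod.cong) (auto simp: measure_pmf_single)
  also have "\<dots> = (\<Prod>e\<in>I \<inter> S. 1 - p)"
    using assms(1) by (rule prod.inter_restrict[symmetric])
  also have "I \<inter> S = S" using assms(2) by auto
  finally show ?thesis by simp
qed

text \<open>Union bound over the pairs \<open>(A, B)\<close> violating expansion: there are at most
  2^n * 2^n of them, and each requires at least s^2 independent potential arcs to be absent.\<close>

lemma prob_D_not_expanding:
  assumes p: "p \<in> {0..1}" and s: "0 \<le> s"
  shows "measure_pmf.prob (D n p) {G. \<not> expanding s G} \<le> 4 ^ n * exp (- p * s\<^sup>2)"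
proof -
  define I where "I = {(i, j). 1 \<le> i \<and> i < j \<and> j \<le> n}"
  define M where "M = Pi_pmf I False (\<lambda>_. bernoulli_pmf p)"
  define Gr where "Gr = (\<lambda>f. \<lparr>pverts = {1..n}, parcs = {e \<in> I. f e}\<rparr>)"
  define W where "W = {(A, B). A \<subseteq> {1..n} \<and> B \<subseteq> {1..n} \<and> A \<inter> B = {} \<and> s \<le> card A \<and> s \<le> card B}"
  define Ev where "Ev = (\<lambda>(A, B). {f. \<forall>e\<in>crossing_pairs A B. \<not> f e})"
  have "I \<subseteq> {1..n} \<times> {1..n}" by (auto simp: I_def)
  then have finI: "finite I" using finite_subset by blast
  have DM: "D n p = map_pmf Gr M" by (simp add: D_def I_def M_def Gr_def)
  have Wsub: "W \<subseteq> Pow {1..n} \<times> Pow {1..n}" by (auto simp: W_def)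
  then have finW: "finite W" using finite_subset by blast
  have "card W \<le> card (Pow {1..n} \<times> Pow {1..n})" using Wsub by (intro card_mono) auto
  also have "\<dots> = 4 ^ n"
    by (simp add: card_cartesian_product card_Pow flip: power_mult_distrib)
  finally have cW: "card W \<le> 4 ^ n" .
  have cross: "crossing_pairs A B \<subseteq> I" if "(A, B) \<in> W" for A B
    using that by (fastforce simp: crossing_pairs_def I_def W_def min_def max_def)
  \<comment> \<open>A violating pair has no arc in either direction, so all its crossing indices
    carry \<open>False\<close>.\<close>
  have sub: "{f. \<not> expanding s (Gr f)} \<subseteq> (\<Union>w\<in>W. Ev w)"
  proof
    fix f assume "f \<in> {f. \<not> expanding s (Gr f)}"
    then obtain A B where AB: "(A, B) \<in> W"
      and none: "\<And>a b. a \<in> A \<Longrightarrow> b \<in> B \<Longrightarrow> (a, b) \<notin> parcs (Gr f) \<and> (b, a) \<notin> parcs (Gr f)"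
      unfolding expanding_def W_def by (auto simp: Gr_def)
    have "\<not> f e" if e: "e \<in> crossing_pairs A B" for e
    proof -
      obtain a b where ab: "a \<in> A" "b \<in> B" "e = (min a b, max a b)"
        using e by (auto simp: crossing_pairs_def)
      have "e = (a, b) \<or> e = (b, a)" using ab(3) by (auto simp: min_def max_def)
      then have "e \<notin> parcs (Gr f)" using none[OF ab(1,2)] by auto
      moreover have "e \<in> I" using cross[OF AB] e by auto
      ultimately show ?thesis by (simp add: Gr_def)
    qed
    then show "f \<in> (\<Union>w\<in>W. Ev w)" using AB by (intro UN_I[of "(A, B)"]) (auto simp: Ev_def)
  qed
  have each: "measure_pmf.prob M (Ev w) \<le> exp (- p * s\<^sup>2)" if w: "w \<in> W" for w
  proof -
    obtain A B where AB: "w = (A, B)" by (cases w)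
    have W: "(A, B) \<in> W" using w AB by simp
    have "measure_pmf.prob M (Ev w) = (1 - p) ^ (card A * card B)"
      using prob_Pi_bernoulli_all_False[OF finI cross[OF W] p] W
      by (simp add: Ev_def AB M_def card_crossing_pairs W_def)
    \<comment> \<open>This uses 0 \<le> 1 - p \<le> exp(-p).\<close>
    also have "\<dots> \<le> exp (- p) ^ (card A * card B)"
      using p exp_ge_add_one_self[of "- p"] by (intro power_mono) auto
    also have "\<dots> = exp (- (p * (real (card A) * real (card B))))"
      by (simp flip: exp_of_nat_mult add: mult_ac)
    also have "s\<^sup>2 \<le> real (card A) * real (card B)"
      unfolding power2_eq_square using W s by (intro mult_mono) (auto simp: W_def)
    then have "exp (- (p * (real (card A) * real (card B)))) \<le> exp (- p * s\<^sup>2)"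
      using p by (simp add: mult_left_mono)
    finally show ?thesis .
  qed
  have "measure_pmf.prob (D n p) {G. \<not> expanding s G} = measure_pmf.prob M {f. \<not> expanding s (Gr f)}"
    by (simp add: DM vimage_def)
  also have "\<dots> \<le> measure_pmf.prob M (\<Union>w\<in>W. Ev w)"
    using sub by (intro measure_pmf.finite_measure_mono) auto
  also have "\<dots> \<le> (\<Sum>w\<in>W. measure_pmf.prob M (Ev w))"
    using finW by (intro measure_pmf.finite_measure_subadditive_finite) auto
  also have "\<dots> \<le> (\<Sum>w\<in>W. exp (- p * s\<^sup>2))" using each by (rule sum_mono)
  also have "\<dots> = real (card W) * exp (- p * s\<^sup>2)" by simp
  also have "\<dots> \<le> 4 ^ n * exp (- p * s\<^sup>2)"
    using of_nat_mono[OF cW, where 'a = real] by (intro mult_right_mono) auto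
  finally show ?thesis .
qed

text \<open>Arcs go from smaller to larger labels, so the identity is a topological ordering; it
  supplies the layout needed to bound the gap.\<close>

lemma set_pmf_D:
  assumes "G \<in> set_pmf (D n p)"
  shows "pverts G = {1..n}" "layout G id"
  using assms by (auto simp: D_def layout_def)

text \<open>Since n^(2-c) = n * n^(1-c) with 1 - c > 0, the exponent outgrows every multiple of n.
  Taking the multiple ln 4 + 1 cancels 4^n and leaves exp(-n).\<close>

lemma union_bound_tendsto_0:
  assumes "c < 1" "0 < k"
  shows "(\<lambda>n. 4 ^ n * exp (- k * real n powr (2 - c))) \<longlonglongrightarrow> 0"
proof (rule tendsto_sandwich[OF _ _ tendsto_const])
  have "filterlim (\<lambda>n. k * real n powr (1 - c)) at_top sequentially"
    using assms by real_asymp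
  then have "eventually (\<lambda>n. ln 4 + 1 \<le> k * real n powr (1 - c)) sequentially"
    by (simp add: filterlim_at_top)
  then show "eventually (\<lambda>n. 4 ^ n * exp (- k * real n powr (2 - c)) \<le> exp (- real n)) sequentially"
    using eventually_gt_at_top[of 0]
  proof eventually_elim
    case (elim n)
    have "real n powr (2 - c) = real n * real n powr (1 - c)"
      using elim(2) powr_add[of "real n" 1 "1 - c"] by simp
    then have "real n * (ln 4 + 1) \<le> k * real n powr (2 - c)"
      using mult_left_mono[OF elim(1), of "real n"] by (simp add: mult_ac)
    then have "exp (real n * ln 4 + (- k * real n powr (2 - c))) \<le> exp (- real n)"
      by (simp add: algebra_simps)
    moreover have "exp (real n * ln 4) = 4 ^ n" by (simp add: exp_of_nat_mult)
    ultimately show ?case by (simp only: exp_add)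
  qed
  show "(\<lambda>n. exp (- real n)) \<longlonglongrightarrow> 0"
    by (rule filterlim_compose[OF exp_at_bot])
      (simp add: filterlim_uminus_at_bot filterlim_real_sequentially)
qed auto

theorem theorem8:
  fixes c :: real and p :: "nat \<Rightarrow> real"
  assumes "0 \<le> c" and "c < 1"
    and "\<And>n. n \<ge> 1 \<Longrightarrow> p n \<in> {0..1}"
    and "p \<in> \<Omega>(\<lambda>n. real n powr (-c))"
  shows "\<forall>\<epsilon>>0. \<forall>\<delta>>0. \<exists>N. \<forall>n\<ge>N.
    measure_pmf.prob (D n (p n)) {G. GAPVB G < ereal (1 + \<delta>)} > 1 - \<epsilon>"
proof (intro allI impI)
  fix \<epsilon> \<delta> :: real assume \<epsilon>: "\<epsilon> > 0" and \<delta>: "\<delta> > 0"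
  obtain k where k: "k > 0" "eventually (\<lambda>n. k * real n powr (-c) \<le> \<bar>p n\<bar>) sequentially"
    using assms(4) by (elim landau_omega.bigE) auto
  \<comment> \<open>The value gives (1 + \<delta>) \<gamma> n = \<delta> n / 8, strictly below
    \<delta> times the half size, which is at least n / 4 once n \<ge> 2. It also keeps \<gamma> n
    below n / 2.\<close>
  define \<gamma> where "\<gamma> = \<delta> / (8 * (1 + \<delta>))"
  have \<gamma>: "0 < \<gamma>" "\<gamma> \<le> 1 / 8" "(1 + \<delta>) * \<gamma> = \<delta> / 8" using \<delta> by (auto simp: \<gamma>_def field_simps)
  have "(\<lambda>n. 4 ^ n * exp (- (k * \<gamma>\<^sup>2) * real n powr (2 - c))) \<longlonglongrightarrow> 0"
    using assms(2) k(1) \<gamma>(1) by (intro union_bound_tendsto_0) auto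
  then have "eventually (\<lambda>n. 4 ^ n * exp (- (k * \<gamma>\<^sup>2) * real n powr (2 - c)) < \<epsilon>) sequentially"
    using \<epsilon> by (rule order_tendstoD)
  then have "eventually (\<lambda>n. measure_pmf.prob (D n (p n)) {G. GAPVB G < ereal (1 + \<delta>)} > 1 - \<epsilon>) sequentially"
    using k(2) eventually_ge_at_top[of 2]
  proof eventually_elim
    case (elim n)
    have pn: "p n \<in> {0..1}" using assms(3) elim(3) by simp
    have h: "real n / 4 \<le> real (n div 2)" using elim(3) by linarith
    have "(1 + \<delta>) * (\<gamma> * real n) = \<delta> * (real n / 8)"
      using \<gamma>(3) by (simp flip: mult.assoc)
    also have "\<dots> < \<delta> * real (n div 2)" using \<delta> h elim(3) by (intro mult_strict_left_mono) auto
    finally have gap: "(1 + \<delta>) * (\<gamma> * real n) < \<delta> * real (n div 2)" .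
    have half: "\<gamma> * real n \<le> real n / 2" using mult_right_mono[OF \<gamma>(2), of "real n"] by simp
    have "1 - measure_pmf.prob (D n (p n)) {G. GAPVB G < ereal (1 + \<delta>)}
        = measure_pmf.prob (D n (p n)) {G. \<not> GAPVB G < ereal (1 + \<delta>)}"
      by (subst measure_pmf.prob_compl[symmetric]) (auto intro!: arg_cong[of _ _ "measure_pmf.prob _"])
    also have "\<dots> \<le> measure_pmf.prob (D n (p n)) {G. \<not> expanding (\<gamma> * real n) G}"
    proof (rule measure_pmf.finite_measure_mono_AE)
      \<comment> \<open>The inclusion of events is needed only on the support of
        \<open>D n (p n)\<close>, where the vertex set is \<open>{1..n}\<close> and a layout
        exists.\<close>
      show "AE G in measure_pmf (D n (p n)). G \<in> {G. \<not> GAPVB G < ereal (1 + \<delta>)} \<longrightarrow>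
          G \<in> {G. \<not> expanding (\<gamma> * real n) G}"
      proof (subst AE_measure_pmf_iff, safe)
        fix G assume G: "G \<in> set_pmf (D n (p n))" and ng: "\<not> GAPVB G < ereal (1 + \<delta>)"
          and ex: "expanding (\<gamma> * real n) G"
        have "GAPVB G < ereal (1 + \<delta>)"
          by (rule expanding_GAPVB_less[OF _ set_pmf_D(2)[OF G] ex])
            (use set_pmf_D(1)[OF G] half gap \<delta> in simp_all)
        then show False using ng by simp
      qed
    qed auto
    also have "\<dots> \<le> 4 ^ n * exp (- p n * (\<gamma> * real n)\<^sup>2)"
      using pn \<gamma>(1) by (intro prob_D_not_expanding) auto
    also have "\<dots> \<le> 4 ^ n * exp (- (k * \<gamma>\<^sup>2) * real n powr (2 - c))"
    proof -
      \<comment> \<open>Multiplying the lower bound p n \<ge> k n^(-c) by (\<gamma> n)^2 turns the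
        exponent into k \<gamma>^2 n^(2-c); the absolute value from \<Omega> disappears because p n
        is nonnegative.\<close>
      have "real n powr (2 - c) = real n powr (- c) * (real n)\<^sup>2"
        using elim(3) powr_add[of "real n" "- c" 2] by (simp add: powr_numeral)
      moreover have "k * real n powr (- c) * (\<gamma> * real n)\<^sup>2 \<le> p n * (\<gamma> * real n)\<^sup>2"
        using elim(2) pn by (intro mult_right_mono) auto
      ultimately show ?thesis by (simp add: power_mult_distrib mult_ac)
    qed
    also have "\<dots> < \<epsilon>" by (rule elim(1))
    finally show ?case by simp
  qed
  then show "\<exists>N. \<forall>n\<ge>N. measure_pmf.prob (D n (p n)) {G. GAPVB G < ereal (1 + \<delta>)} > 1 - \<epsilon>"
    by (simp add: eventually_sequentially)
qed

end
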